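(* Let $\frac12<\theta<1$ and $a>(4/e)(1-\theta)$ be fixed, and let $\mathfrak{B}$ be a system of generalized Beurling primes satisfying properties (i)–(iv) listed in the context. Let $\mu_{\mathfrak{B}}$ be the associated Möbius function and $\Delta(x)=\sum^*_{n\le x}\mu_{\mathfrak{B}}(n)$, the sum being over Beurling integers $n\le x$. For $\epsilon>0$ and $C>0$ put $$\mathcal{A}_1(C,\epsilon)=\{x\ge1:\Delta(x)>Cx^{1-\epsilon}\},\qquad \mathcal{A}_2(C,\epsilon)=\{x\ge1:\Delta(x)<-Cx^{1-\epsilon}\}.$$ Then for every sufficiently small $\epsilon>0$ and every constant $C>0$, as $T\to\infty$, $$\mathfrak{m}(\mathcal{A}_j(C,\epsilon)\cap[T,2T])=\Omega\left(T^{1-2\epsilon}\right)\qquad\text{for } j=1,2.$$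
   Context: A system of generalized Beurling primes is a sequence of real numbers $\mathfrak{B}=\{p_j\}_{j\ge1}$ with $1<p_j\le p_{j+1}$. The associated Beurling integers form the multiset of all finite products $p_{\nu_1}^{\alpha_1}\cdots p_{\nu_m}^{\alpha_m}$ with $\nu_1<\dots<\nu_m$ and $\alpha_i\in\mathbb{N}$ positive (including the empty product $1$), counted with multiplicity. $N_{\mathfrak{B}}(x)$ is the number of Beurling integers $\le x$, and $\zeta_{\mathfrak{B}}(s)=\prod_{j\ge1}(1-p_j^{-s})^{-1}$ (with its analytic continuation). Write $s=\sigma+it$. Properties assumed of $\mathfrak{B}$ (such systems exist by a theorem of Diamond, Montgomery and Vorhauer): (i) $N_{\mathfrak{B}}(x)=\kappa x+O(x^\theta)$ for some $\kappa>0$; (ii) $\zeta_{\mathfrak{B}}(s)$ is analytic for $\sigma\ge\theta$ except for a simple pole at $s=1$ with residue $\kappa$; (iii) $\zeta_{\mathfrak{B}}(s)$ has infinitely many zeros on the curve $\sigma=1-a/\log t$, $t\ge2$, and no zeros to the right of this curve; (iv) $\sum_{p^k\le x}\log p=x+O\big(x\exp(-2\sqrt{a\log x})\big)$, the sum being over powers $p^k$ ($k\ge1$) of elements $p$ of $\mathfrak{B}$. The Möbius function $\mu_{\mathfrak{B}}$ is the multiplicative function supported on squarefree Beurling integers with $\mu_{\mathfrak{B}}(p_j)=-1$; i.e. it is $(-1)^m$ on a product of $m$ primes with distinct indices and $0$ if some exponent $\alpha_i\ge2$. $\sum^*_{n\le x}$ means that terms with $n=x$ are counted with weight $\frac12$.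 $\mathfrak{m}$ is Lebesgue measure on $\mathbb{R}$. For nonnegative $F$ and positive $f$, $F(T)=\Omega(f(T))$ as $T\to\infty$ means $\limsup_{T\to\infty}F(T)/f(T)>0$. *)

theory Defs
  imports "HOL-Complex_Analysis.Complex_Analysis" "HOL-Library.Landau_Symbols"
    "HOL-Library.Multiset"
begin

definition beurling_primes :: "(nat \<Rightarrow> real) \<Rightarrow> bool" where
  "beurling_primes p \<longleftrightarrow> (\<forall>j. 1 < p j \<and> p j \<le> p (Suc j))"

(* A Beurling integer is represented by the multiset of the indices of its prime factors, so
   that count M j is the exponent of p j. Formally different products with the same value are
   different multisets, which is what counting with multiplicity means. *)
definition beurling_value :: "(nat \<Rightarrow> real) \<Rightarrow> nat multiset \<Rightarrow> real" where
  "beurling_value p M = (\<Prod>j\<in>#M. p j)"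

definition beurling_upto :: "(nat \<Rightarrow> real) \<Rightarrow> real \<Rightarrow> nat multiset set" where
  "beurling_upto p x = {M. beurling_value p M \<le> x}"

(* If p is bounded, beurling_upto p x is infinite for all large x and card gives 0 there; this
   is incompatible with N(x) = kappa * x + O(x powr theta), kappa > 0, theta < 1. *)
definition beurling_N :: "(nat \<Rightarrow> real) \<Rightarrow> real \<Rightarrow> nat" where
  "beurling_N p x = card (beurling_upto p x)"

definition beurling_psi :: "(nat \<Rightarrow> real) \<Rightarrow> real \<Rightarrow> real" where
  "beurling_psi p x = (\<Sum>(j, k) \<in> {(j, k). 1 \<le> k \<and> p j ^ k \<le> x}. ln (p j))"

definition beurling_euler_product :: "(nat \<Rightarrow> real) \<Rightarrow> complex \<Rightarrow> complex" where
  "beurling_euler_product p s = (\<Prod>j. inverse (1 - complex_of_real (p j) powr (- s)))"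

(* The zeta function on the half-plane Re s >= theta: values outside that half-plane and at the
   point 1 are unconstrained. On the rest it is unique by the identity theorem. *)
definition beurling_zeta_continuation ::
    "(nat \<Rightarrow> real) \<Rightarrow> real \<Rightarrow> (complex \<Rightarrow> complex) \<Rightarrow> bool" where
  "beurling_zeta_continuation p \<theta> Z \<longleftrightarrow>
     Z analytic_on ({s. \<theta> \<le> Re s} - {1}) \<and>
     (\<forall>s. 1 < Re s \<longrightarrow> Z s = beurling_euler_product p s)"

definition beurling_moebius :: "nat multiset \<Rightarrow> real" where
  "beurling_moebius M = (if \<forall>j. count M j \<le> 1 then (- 1) ^ size M else 0)"

definition beurling_Delta :: "(nat \<Rightarrow> real) \<Rightarrow> real \<Rightarrow> real" where
  "beurling_Delta p x =
     (\<Sum>M \<in> beurling_upto p x.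
        (if beurling_value p M = x then 1 / 2 else 1) * beurling_moebius M)"

definition set_A1 :: "(nat \<Rightarrow> real) \<Rightarrow> real \<Rightarrow> real \<Rightarrow> real set" where
  "set_A1 p C \<epsilon> = {x. 1 \<le> x \<and> beurling_Delta p x > C * x powr (1 - \<epsilon>)}"

definition set_A2 :: "(nat \<Rightarrow> real) \<Rightarrow> real \<Rightarrow> real \<Rightarrow> real set" where
  "set_A2 p C \<epsilon> = {x. 1 \<le> x \<and> beurling_Delta p x < - C * x powr (1 - \<epsilon>)}"

(* Omega in the sense of Hardy and Littlewood, not the bigomega of Landau_Symbols, which
   requires a lower bound for all sufficiently large arguments. *)
definition is_Omega :: "(real \<Rightarrow> real) \<Rightarrow> (real \<Rightarrow> real) \<Rightarrow> bool" where
  "is_Omega F f \<longleftrightarrow> Limsup at_top (\<lambda>T. ereal (F T / f T)) > 0"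

end

theory Submission imports Defs begin

text \<open>Suppose \<open>\<Delta>(x) > C x\<^sup>1\<^sup>-\<^sup>\<epsilon>\<close> held only on a set \<open>A\<close> of measure at most \<open>T\<^sup>1\<^sup>-\<^sup>2\<^sup>\<epsilon>\<close> in \<open>[T, 2T]\<close>
  for all large \<open>T\<close>, and split \<open>C x\<^sup>1\<^sup>-\<^sup>\<epsilon> - \<Delta>(x)\<close> into its positive and negative part. The
  negative part lives on \<open>A\<close> and is trivially \<open>O(x)\<close>, so its Mellin transform converges for
  \<open>\<sigma> > 1 - 2\<epsilon>\<close>. The Mellin transform of \<open>\<Delta>\<close> is \<open>1 / (s \<zeta>(s))\<close>, which is regular on the real
  segment \<open>\<sigma> > 1 - \<epsilon>\<close>, because the pole of zeta isolates the point \<open>1\<close> from real zeros. Landau's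
  theorem then makes the transform of the positive part converge for \<open>\<sigma> > 1 - \<epsilon>\<close>, so
  \<open>1 / (s \<zeta>(s))\<close> continues to that half-plane. This is impossible, as the zeros on the curve
  \<open>\<sigma> = 1 - a / log t\<close> come arbitrarily close to the line \<open>\<sigma> = 1\<close>.\<close>

section \<open>Landau's theorem for Laplace transforms\<close>

text \<open>The exponent function \<open>L\<close> is left general so that the choice of
  \<open>lborel\<close> and \<open>ln\<close> makes this a Mellin transform.\<close>

definition laplace :: "'a measure \<Rightarrow> ('a \<Rightarrow> real) \<Rightarrow> ('a \<Rightarrow> real) \<Rightarrow> complex \<Rightarrow> complex" where
  "laplace M L w s = (\<integral>x. of_real (w x) * exp (- (s * of_real (L x))) \<partial>M)"

definition laplace_converges :: "'a measure \<Rightarrow> ('a \<Rightarrow> real) \<Rightarrow> ('a \<Rightarrow> real) \<Rightarrow> real \<Rightarrow> bool" where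
  "laplace_converges M L w b \<longleftrightarrow> integrable M (\<lambda>x. w x * exp (- (b * L x)))"

section \<open>Term-by-term expansion and holomorphy of the transform\<close>

lemma partial_sum_exp_le:
  fixes y :: real
  assumes "0 \<le> y"
  shows "(\<Sum>k<n. y ^ k / fact k) \<le> exp y"
proof -
  have "(\<lambda>k. y ^ k / fact k) sums exp y"
    using exp_converges[of y] by (simp add: divide_inverse mult.commute)
  then show ?thesis
    using assms by (metis (no_types, lifting) divide_nonneg_pos fact_gt_zero sum_le_suminf sums_iff
        finite_lessThan zero_le_power)
qed

text \<open>The sign of \<open>L\<close> matters only on the support of \<open>w\<close>:
  \<open>ln\<close> is negative on (0, 1), where the weights used later vanish.\<close>

locale nonneg_laplace =
  fixes M :: "'a measure" and L w :: "'a \<Rightarrow> real"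
  assumes L_meas [measurable]: "L \<in> borel_measurable M"
    and w_meas [measurable]: "w \<in> borel_measurable M"
    and w_nonneg: "0 \<le> w x"
    and L_nonneg: "w x \<noteq> 0 \<Longrightarrow> 0 \<le> L x"
begin

text \<open>The \<open>k\<close>-th Taylor coefficient of the transform at \<open>s\<close>,
  obtained by differentiating under the integral sign.\<close>

definition coeff :: "complex \<Rightarrow> nat \<Rightarrow> complex" where
  "coeff s k = (\<integral>x. of_real (w x) * exp (- (s * of_real (L x))) * (- of_real (L x)) ^ k / fact k \<partial>M)"

lemma converges_mono:
  assumes "laplace_converges M L w b" "b \<le> c"
  shows "laplace_converges M L w c"
  unfolding laplace_converges_def
proof (rule Bochner_Integration.integrable_bound)
  show "integrable M (\<lambda>x. w x * exp (- (b * L x)))"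
    using assms by (simp add: laplace_converges_def)
  have "w x * exp (- (c * L x)) \<le> w x * exp (- (b * L x))" for x
    using w_nonneg[of x] L_nonneg[of x] assms(2)
    by (cases "w x = 0") (auto intro!: mult_left_mono mult_right_mono)
  then show "AE x in M. norm (w x * exp (- (c * L x))) \<le> norm (w x * exp (- (b * L x)))"
    using w_nonneg by (auto simp: abs_mult)
qed simp

text \<open>Expand \<open>exp (- (z * L x))\<close> under the integral. The absolute values of the
  terms add up to at most \<open>w x * exp (- ((Re s - norm z) * L x))\<close>, which the convergent
  integrand at \<open>b\<close> dominates, so sum and integral may be exchanged.\<close>

lemma laplace_power_series:
  assumes conv: "laplace_converges M L w b" and z: "norm z \<le> Re s - b"
  shows "(\<lambda>k. coeff s k * z ^ k) sums laplace M L w (s + z)"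
    and "integrable M (\<lambda>x. of_real (w x) * exp (- (s * of_real (L x))) * (- of_real (L x)) ^ k / fact k * z ^ k)"
proof -
  define f where "f = (\<lambda>k x. of_real (w x) * exp (- (s * of_real (L x))) * (- of_real (L x)) ^ k / fact k * z ^ k :: complex)"
  have f_meas [measurable]: "f k \<in> borel_measurable M" for k
    unfolding f_def by measurable
  have int: "integrable M (\<lambda>x. w x * exp (- (b * L x)))"
    using conv by (simp add: laplace_converges_def)
  have norm_f: "(\<Sum>k<n. norm (f k x)) \<le> w x * exp (- (b * L x))" for n x
  proof (cases "w x = 0")
    case False
    have "(\<Sum>k<n. norm (f k x)) = w x * exp (- (Re s * L x)) * (\<Sum>k<n. (L x * norm z) ^ k / fact k)"
      unfolding sum_distrib_left
      using L_nonneg[OF False] w_nonneg[of x]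
      by (intro sum.cong) (auto simp: f_def norm_mult norm_divide norm_power power_mult_distrib)
    also have "\<dots> \<le> w x * exp (- (Re s * L x)) * exp (L x * norm z)"
      using L_nonneg[OF False] w_nonneg[of x] by (intro mult_left_mono partial_sum_exp_le) auto
    also have "\<dots> = w x * exp (- ((Re s - norm z) * L x))"
      by (simp add: algebra_simps flip: exp_add)
    also have "\<dots> \<le> w x * exp (- (b * L x))"
      using L_nonneg[OF False] w_nonneg[of x] z by (auto intro!: mult_left_mono mult_right_mono)
    finally show ?thesis .
  qed (simp add: f_def)
  have norm_sum: "norm (\<Sum>k<n. f k x) \<le> w x * exp (- (b * L x))" for n x
    using norm_sum[of "\<lambda>k. f k x" "{..<n}"] norm_f[where n=n and x=x] by linarith
  have f_int: "integrable M (f k)" for k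
  proof (rule Bochner_Integration.integrable_bound[OF int])
    have "norm (f k x) \<le> (\<Sum>k<Suc k. norm (f k x))" for x
      by (simp add: sum_nonneg)
    then show "AE x in M. norm (f k x) \<le> norm (w x * exp (- (b * L x)))"
      using norm_f[where n = "Suc k"] by (intro AE_I2) (smt (verit) real_norm_def)
  qed simp
  then show "integrable M (\<lambda>x. of_real (w x) * exp (- (s * of_real (L x))) * (- of_real (L x)) ^ k / fact k * z ^ k)"
    unfolding f_def .
  have lim: "(\<lambda>n. \<Sum>k<n. f k x) \<longlonglongrightarrow> of_real (w x) * exp (- ((s + z) * of_real (L x)))" for x
  proof -
    have "(\<lambda>k. (- of_real (L x) * z) ^ k / fact k) sums exp (- of_real (L x) * z)"
      using exp_converges[of "- of_real (L x) * z"] by (simp add: scaleR_conv_of_real field_simps)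
    then have "(\<lambda>k. (- of_real (L x)) ^ k * z ^ k / fact k) sums exp (- of_real (L x) * z)"
      by (simp only: power_mult_distrib)
    from sums_mult[OF this, of "of_real (w x) * exp (- (s * of_real (L x)))"]
    have "(\<lambda>k. f k x) sums (of_real (w x) * exp (- (s * of_real (L x))) * exp (- of_real (L x) * z))"
      by (simp add: f_def mult_ac)
    also have "of_real (w x) * exp (- (s * of_real (L x))) * exp (- of_real (L x) * z)
        = of_real (w x) * exp (- ((s + z) * of_real (L x)))"
      by (simp add: algebra_simps flip: exp_add)
    finally show ?thesis by (simp add: sums_def)
  qed
  have "(\<lambda>n. \<integral>x. (\<Sum>k<n. f k x) \<partial>M) \<longlonglongrightarrow> laplace M L w (s + z)"
    unfolding laplace_def
    by (rule integral_dominated_convergence[OF _ _ int]) (use lim norm_sum in auto)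
  moreover have "(\<integral>x. (\<Sum>k<n. f k x) \<partial>M) = (\<Sum>k<n. coeff s k * z ^ k)" for n
  proof -
    have "(\<integral>x. f k x \<partial>M) = coeff s k * z ^ k" for k
      unfolding f_def coeff_def by (rule integral_mult_left_zero)
    then show ?thesis
      by (simp add: Bochner_Integration.integral_sum f_int)
  qed
  ultimately show "(\<lambda>k. coeff s k * z ^ k) sums laplace M L w (s + z)"
    by (simp add: sums_def)
qed

lemma laplace_holomorphic:
  assumes "\<And>b. b > \<alpha> \<Longrightarrow> laplace_converges M L w b"
  shows "laplace M L w holomorphic_on {s. Re s > \<alpha>}"
proof -
  have "laplace M L w analytic_on {s}" if "Re s > \<alpha>" for s
  proof -
    \<comment> \<open>Half the distance to the boundary line leaves \<open>Re s - r\<close> above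
      \<alpha>, so one abscissa serves the whole ball.\<close>
    define r where "r = (Re s - \<alpha>) / 2"
    have "r > 0" using that by (simp add: r_def)
    have "laplace M L w holomorphic_on ball s r"
    proof (rule power_series_holomorphic)
      fix z assume "z \<in> ball s r"
      then have "norm (z - s) \<le> Re s - (Re s - r)"
        by (simp add: dist_norm norm_minus_commute)
      moreover have "laplace_converges M L w (Re s - r)"
        using that by (intro assms) (simp add: r_def field_simps)
      ultimately have "(\<lambda>k. coeff s k * (z - s) ^ k) sums laplace M L w (s + (z - s))"
        by (intro laplace_power_series)
      then show "(\<lambda>k. coeff s k * (z - s) ^ k) sums laplace M L w z"
        by simp
    qed
    then show ?thesis
      using \<open>r > 0\<close> analytic_at_ball by blast
  qed
  then have "laplace M L w analytic_on {s. Re s > \<alpha>}"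
    by (subst analytic_on_analytic_at) auto
  then show ?thesis
    by (rule analytic_imp_holomorphic)
qed

section \<open>Alternating Taylor coefficients and the abscissa of convergence\<close>

lemma coeff_of_real:
  "coeff (of_real c) k = of_real ((-1) ^ k * (\<integral>x. w x * exp (- (c * L x)) * L x ^ k / fact k \<partial>M))"
proof -
  have "coeff (of_real c) k
      = (\<integral>x. of_real ((-1) ^ k * (w x * exp (- (c * L x)) * L x ^ k / fact k)) \<partial>M)"
    unfolding coeff_def
    by (intro Bochner_Integration.integral_cong)
       (auto simp: power_minus[of "of_real _"] mult_ac simp flip: exp_of_real)
  then show ?thesis
    by (simp only: integral_complex_of_real integral_mult_right_zero)
qed

text \<open>The Taylor coefficients at \<open>c\<close> alternate in sign, so evaluating the Taylor series to the
  left of \<open>c\<close> yields a series of nonnegative terms; by monotone convergence the integral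
  converges wherever that series does.\<close>

lemma converges_left_of_centre:
  assumes conv: "laplace_converges M L w b" "b < c" and "0 \<le> r"
    and sum: "summable (\<lambda>k. coeff (of_real c) k * (- of_real r) ^ k)"
  shows "laplace_converges M L w (c - r)"
proof -
  define f where "f = (\<lambda>k x. w x * exp (- (c * L x)) * L x ^ k / fact k * r ^ k)"
  have f_nonneg: "f k x \<ge> 0" for k x
    using w_nonneg[of x] L_nonneg[of x] \<open>0 \<le> r\<close> by (cases "w x = 0") (auto simp: f_def)
  have f_int: "integrable M (f k)" for k
  proof -
    \<comment> \<open>Integrability is known only for terms carrying the factor
      \<open>z ^ k\<close>; the admissible nonzero choice \<open>z = c - b\<close> allows that
      factor to be divided out.\<close>
    have "norm (complex_of_real (c - b)) \<le> Re (of_real c) - b"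
      using \<open>b < c\<close> by (simp flip: of_real_diff)
    note int = laplace_power_series(2)[OF conv(1) this, of k]
    have "(- complex_of_real (L x)) ^ k * complex_of_real (c - b) ^ k
        = of_real (L x ^ k * (b - c) ^ k)" for x
      by (simp add: algebra_simps flip: power_mult_distrib)
    then have eq: "of_real (w x) * exp (- (of_real c * of_real (L x))) * (- of_real (L x)) ^ k / fact k
          * of_real (c - b) ^ k
        = complex_of_real (w x * exp (- (c * L x)) * L x ^ k / fact k * (b - c) ^ k)" for x
      by (simp add: field_simps flip: exp_of_real)
    have "integrable M (\<lambda>x. complex_of_real (w x * exp (- (c * L x)) * L x ^ k / fact k * (b - c) ^ k))"
      using int by (simp only: eq)
    then have "integrable M (\<lambda>x. w x * exp (- (c * L x)) * L x ^ k / fact k * (b - c) ^ k)"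
      by (simp only: complex_of_real_integrable_eq)
    then have "integrable M (\<lambda>x. w x * exp (- (c * L x)) * L x ^ k / fact k * (b - c) ^ k / (b - c) ^ k)"
      by (rule integrable_divide_zero)
    moreover have "y * (b - c) ^ k / (b - c) ^ k = y" for y
      using \<open>b < c\<close> by simp
    ultimately have "integrable M (\<lambda>x. w x * exp (- (c * L x)) * L x ^ k / fact k)"
      by (simp only:)
    then show ?thesis
      unfolding f_def by (rule integrable_mult_left)
  qed
  have f_sums: "(\<lambda>k. f k x) sums (w x * exp (- ((c - r) * L x)))" for x
  proof -
    have "(\<lambda>k. (L x * r) ^ k / fact k) sums exp (L x * r)"
      using exp_converges[of "L x * r"] by (simp add: field_simps)
    from sums_mult[OF this, of "w x * exp (- (c * L x))"]
    have "(\<lambda>k. f k x) sums (w x * exp (- (c * L x)) * exp (L x * r))"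
      by (simp add: f_def power_mult_distrib mult_ac)
    also have "w x * exp (- (c * L x)) * exp (L x * r) = w x * exp (- ((c - r) * L x))"
      by (simp add: algebra_simps flip: exp_add)
    finally show ?thesis .
  qed
  have coeff_eq: "coeff (of_real c) k * (- of_real r) ^ k = of_real (\<integral>x. f k x \<partial>M)" for k
  proof -
    define I where "I = (\<integral>x. w x * exp (- (c * L x)) * L x ^ k / fact k \<partial>M)"
    have "(-1) ^ k * (- r) ^ k = r ^ k"
      by (simp flip: power_mult_distrib)
    then have "((-1) ^ k * I) * (- r) ^ k = I * r ^ k"
      by (metis mult.assoc mult.commute)
    then have "of_real ((-1) ^ k * I) * (- of_real r) ^ k = complex_of_real (I * r ^ k)"
      by (simp only: flip: of_real_mult of_real_minus of_real_power)
    then show ?thesis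
      unfolding coeff_of_real f_def integral_mult_left_zero I_def .
  qed
  have "summable (\<lambda>k. \<integral>x. f k x \<partial>M)"
    using sum unfolding coeff_eq by (simp only: summable_complex_of_real)
  then have "integrable M (\<lambda>x. \<Sum>k. f k x)"
    using f_nonneg f_int f_sums by (intro integrable_suminf) (auto simp: sums_iff)
  then show ?thesis
    using f_sums by (simp add: laplace_converges_def sums_iff)
qed

text \<open>Were the abscissa of convergence \<sigma> above \<alpha>, then \<open>F\<close> would be
  holomorphic around \<sigma>. Its Taylor series about a centre slightly to the right then converges
  at a point left of \<sigma>, and for nonnegative weights this forces the integral to converge
  there. Convexity of \<open>U\<close> keeps its intersections with half-planes connected, as the
  identity theorem requires.\<close>

theorem landau:
  assumes conv: "laplace_converges M L w \<beta>"
    and U: "open U" "convex U" and F: "F holomorphic_on U"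
    and ray: "\<And>x. x > \<alpha> \<Longrightarrow> complex_of_real x \<in> U"
    and eq: "\<And>s. s \<in> U \<Longrightarrow> Re s > \<beta> \<Longrightarrow> F s = laplace M L w s"
    and b: "b > \<alpha>"
  shows "laplace_converges M L w b"
proof (rule ccontr)
  assume not_conv: "\<not> laplace_converges M L w b"
  define E where "E = {b. laplace_converges M L w b}"
  define \<sigma> where "\<sigma> = Inf E"
  have lower: "b \<le> x" if "x \<in> E" for x
    using that not_conv converges_mono[of x b] by (auto simp: E_def not_le intro: less_imp_le leI)
  have "E \<noteq> {}" "bdd_below E"
    using conv lower by (auto simp: E_def intro!: bdd_belowI)
  then have "b \<le> \<sigma>" and \<sigma>_le: "\<And>x. x \<in> E \<Longrightarrow> \<sigma> \<le> x"
    unfolding \<sigma>_def using lower by (auto intro: cInf_greatest cInf_lower)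
  have conv_gt: "laplace_converges M L w x" if "x > \<sigma>" for x
    using that \<open>E \<noteq> {}\<close> \<open>bdd_below E\<close> converges_mono
    unfolding \<sigma>_def by (auto simp: cInf_less_iff E_def)
  have holo: "laplace M L w holomorphic_on {s. Re s > \<sigma>}"
    by (rule laplace_holomorphic) (rule conv_gt)
  have F_eq: "F s = laplace M L w s" if "s \<in> U" "Re s > \<sigma>" for s
  proof (rule analytic_continuation_open[where f = F and g = "laplace M L w" and s = "U \<inter> {s. Re s > max \<beta> \<sigma>}"
      and s' = "U \<inter> {s. Re s > \<sigma>}"])
    have "complex_of_real (max (max \<alpha> \<beta>) \<sigma> + 1) \<in> U"
      by (rule ray) auto
    then show "U \<inter> {s. Re s > max \<beta> \<sigma>} \<noteq> {}"
      by (auto intro!: exI[of _ "complex_of_real (max (max \<alpha> \<beta>) \<sigma> + 1)"])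
    show "open (U \<inter> {s. Re s > max \<beta> \<sigma>})"
      using U(1) open_halfspace_Re_gt by (rule open_Int)
    show "connected (U \<inter> {s. Re s > \<sigma>})"
      using U by (intro convex_connected convex_Int convex_halfspace_Re_gt) auto
  qed (use U F holo that eq in \<open>auto intro!: open_Int open_halfspace_Re_gt elim: holomorphic_on_subset\<close>)
  have "complex_of_real \<sigma> \<in> U"
    using \<open>b \<le> \<sigma>\<close> b by (intro ray) auto
  then obtain e where e: "e > 0" "ball (complex_of_real \<sigma>) e \<subseteq> U"
    using U by (meson openE)
  \<comment> \<open>With \<open>e = 3 * \<delta>\<close> the disc of radius
    \<open>2 * \<delta>\<close> about \<open>c = \<sigma> + \<delta>\<close> still lies in
    \<open>U\<close>, and it contains \<open>c - 3 / 2 * \<delta> = \<sigma> - \<delta> / 2\<close>,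
    a point left of \<sigma>.\<close>
  define \<delta> where "\<delta> = e / 3"
  define c where "c = \<sigma> + \<delta>"
  have \<delta>: "\<delta> > 0" using e by (simp add: \<delta>_def)
  have ball_c: "ball (complex_of_real c) (2 * \<delta>) \<subseteq> U"
  proof -
    have "ball (complex_of_real c) (2 * \<delta>) \<subseteq> ball (complex_of_real \<sigma>) e"
      using \<delta> by (subst ball_subset_ball_iff) (auto simp: c_def \<delta>_def dist_norm)
    then show ?thesis using e by blast
  qed
  define a where "a = (\<lambda>k. (deriv ^^ k) F (of_real c) / fact k)"
  have F_sums: "(\<lambda>k. a k * z ^ k) sums F (of_real c + z)" if "norm z < 2 * \<delta>" for z
    using holomorphic_power_series[OF holomorphic_on_subset[OF F ball_c], of "of_real c + z"] that
    by (simp add: a_def dist_norm)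
  have F_exp: "(\<lambda>z. F (of_real c + z)) has_fps_expansion Abs_fps a"
  proof (rule has_fps_expansionI)
    have "eventually (\<lambda>z. z \<in> ball 0 (2 * \<delta>)) (nhds (0::complex))"
      using \<delta> by (intro eventually_nhds_in_open) auto
    then show "\<forall>\<^sub>F u in nhds 0. (\<lambda>n. fps_nth (Abs_fps a) n * u ^ n) sums F (of_real c + u)"
      by eventually_elim (auto simp: F_sums)
  qed
  \<comment> \<open>This second expansion is established only near the centre, where the integral
    converges; uniqueness of power series identifies its coefficients with those of
    \<open>F\<close>.\<close>
  moreover have "(\<lambda>z. F (of_real c + z)) has_fps_expansion Abs_fps (coeff (of_real c))"
  proof (rule has_fps_expansionI)
    have "eventually (\<lambda>z. z \<in> ball 0 (\<delta> / 2)) (nhds (0::complex))"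
      using \<delta> by (intro eventually_nhds_in_open) auto
    then show "\<forall>\<^sub>F u in nhds 0. (\<lambda>n. fps_nth (Abs_fps (coeff (of_real c))) n * u ^ n) sums F (of_real c + u)"
    proof eventually_elim
      case (elim u)
      have "(\<lambda>k. coeff (of_real c) k * u ^ k) sums laplace M L w (of_real c + u)"
        using elim \<delta> by (intro laplace_power_series[OF conv_gt[of "\<sigma> + \<delta> / 2"]]) (auto simp: c_def)
      moreover have "of_real c + u \<in> ball (of_real c) (2 * \<delta>)"
        using elim \<delta> by (simp add: dist_norm)
      moreover have "\<bar>Re u\<bar> < \<delta>"
        using elim \<delta> abs_Re_le_cmod[of u] by simp
      ultimately show ?case
        using F_eq[of "of_real c + u"] ball_c by (auto simp: c_def)
    qed
  qed
  ultimately have "Abs_fps a = Abs_fps (coeff (of_real c))"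
    by (rule fps_expansion_unique_complex)
  then have "a = coeff (of_real c)"
    by (metis fps_nth_Abs_fps ext)
  moreover have "summable (\<lambda>k. a k * (- of_real (3 / 2 * \<delta>)) ^ k)"
    using F_sums[of "- of_real (3 / 2 * \<delta>)"] \<delta> by (auto simp: sums_iff norm_mult)
  ultimately have "laplace_converges M L w (c - 3 / 2 * \<delta>)"
    using \<delta> by (intro converges_left_of_centre[OF conv_gt[of "\<sigma> + \<delta> / 2"]]) (auto simp: c_def)
  then have "\<sigma> \<le> c - 3 / 2 * \<delta>"
    by (intro \<sigma>_le) (simp add: E_def)
  then show False
    using \<delta> by (simp add: c_def)
qed

end

section \<open>A one-sided oscillation criterion\<close>

lemma powr_tail_integral:
  fixes b v :: real
  assumes "b > 0" "v > 0"
  shows "has_bochner_integral lborel (\<lambda>x. indicator {v..} x * x powr (- b - 1)) (v powr (- b) / b)"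
proof (rule has_bochner_integral_nn_integral)
  have "((\<lambda>x. - (x powr (- b) / b)) \<longlongrightarrow> - (0 / b)) at_top"
    using assms by (intro tendsto_intros tendsto_neg_powr filterlim_ident) auto
  moreover have "((\<lambda>x. - (x powr (- b) / b)) has_real_derivative x powr (- b - 1)) (at x)" if "v \<le> x" for x
    using assms that by (auto intro!: derivative_eq_intros simp: field_simps)
  ultimately have "(\<integral>\<^sup>+x. ennreal (x powr (- b - 1)) * indicator {v..} x \<partial>lborel)
      = ennreal (- (0 / b) - - (v powr (- b) / b))"
    by (intro nn_integral_FTC_atLeast) auto
  also have "(\<integral>\<^sup>+x. ennreal (x powr (- b - 1)) * indicator {v..} x \<partial>lborel)
      = (\<integral>\<^sup>+x. ennreal (indicator {v..} x * x powr (- b - 1)) \<partial>lborel)"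
    by (intro nn_integral_cong) (auto simp: indicator_def)
  finally show "(\<integral>\<^sup>+x. ennreal (indicator {v..} x * x powr (- b - 1)) \<partial>lborel) = ennreal (v powr (- b) / b)"
    by simp
qed (use assms in auto)

text \<open>On the block from \<open>2 ^ k\<close> to \<open>2 * 2 ^ k\<close> the integrand is at
  most \<open>(2 ^ k) powr (- b)\<close>, since \<open>b \<ge> 0\<close>; the measure bound then
  makes the block integral at most \<open>(2 powr (\<alpha> - b)) ^ k\<close> for large
  \<open>k\<close>, a convergent geometric series.\<close>

lemma dyadic_integrable:
  fixes A :: "real set"
  assumes [measurable]: "A \<in> sets borel" and A: "A \<subseteq> {1..}"
    and small: "\<forall>\<^sub>F T in at_top. measure lborel (A \<inter> {T..2 * T}) \<le> T powr \<alpha>"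
    and b: "b \<ge> 0" "b > \<alpha>"
  shows "integrable lborel (\<lambda>x. indicator A x * x powr (- b))"
proof -
  define f :: "nat \<Rightarrow> real \<Rightarrow> real"
    where "f = (\<lambda>k x. indicator (A \<inter> {2 ^ k..2 * 2 ^ k}) x * (2 ^ k) powr (- b))"
  have fin: "emeasure lborel (A \<inter> {x..y}) < \<infinity>" for x y
  proof -
    have "emeasure lborel (A \<inter> {x..y}) \<le> emeasure lborel {x..y}"
      by (intro emeasure_mono) auto
    also have "\<dots> < \<infinity>"
      by (cases "x \<le> y") auto
    finally show ?thesis .
  qed
  have f_int: "has_bochner_integral lborel (f k) (measure lborel (A \<inter> {2 ^ k..2 * 2 ^ k}) * (2 ^ k) powr (- b))" for k
    unfolding f_def
    by (intro has_bochner_integral_mult_left has_bochner_integral_real_indicator fin) auto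
  have f_nonneg: "f k x \<ge> 0" for k x
    by (simp add: f_def)
  have f_summable: "summable (\<lambda>k. f k x)" for x
  proof -
    obtain n where n: "x < 2 ^ n"
      using real_arch_pow[of 2 x] by auto
    have "f k x = 0" if "k \<notin> {..<n}" for k
    proof -
      have "(2::real) ^ n \<le> 2 ^ k"
        using that by (intro power_increasing) auto
      then have "x < 2 ^ k"
        using n by linarith
      then show ?thesis
        by (auto simp: f_def indicator_def)
    qed
    then show ?thesis
      by (intro summable_finite[of "{..<n}"]) auto
  qed
  have "summable (\<lambda>k. \<integral>x. norm (f k x) \<partial>lborel)"
  proof (rule summable_comparison_test_ev)
    have "filterlim (\<lambda>k::nat. (2::real) ^ k) at_top sequentially"
      by (intro filterlim_at_infinity_imp_filterlim_at_top filterlim_realpow_sequentially_gt1) auto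
    from eventually_compose_filterlim[OF small this]
    show "\<forall>\<^sub>F k in sequentially. norm (\<integral>x. norm (f k x) \<partial>lborel) \<le> (2 powr (\<alpha> - b)) ^ k"
    proof eventually_elim
      case (elim k)
      have "(\<integral>x. norm (f k x) \<partial>lborel) = measure lborel (A \<inter> {2 ^ k..2 * 2 ^ k}) * (2 ^ k) powr (- b)"
        using f_int[of k] f_nonneg by (simp add: has_bochner_integral_iff)
      also have "\<dots> \<le> (2 ^ k) powr \<alpha> * (2 ^ k) powr (- b)"
        using elim by (intro mult_right_mono) auto
      also have "\<dots> = (2 powr (\<alpha> - b)) ^ k"
        by (simp add: powr_powr algebra_simps flip: powr_add powr_realpow)
      finally show ?case
        by (simp add: f_nonneg)
    qed
    have "2 powr (\<alpha> - b) < 2 powr 0"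
      using b by (intro powr_less_mono) auto
    then show "summable (\<lambda>k. (2 powr (\<alpha> - b)) ^ k)"
      by (intro summable_geometric) auto
  qed
  then have "integrable lborel (\<lambda>x. \<Sum>k. f k x)"
    using f_int f_summable f_nonneg by (intro integrable_suminf) (auto simp: has_bochner_integral_iff)
  then show ?thesis
  proof (rule Bochner_Integration.integrable_bound)
    have "indicator A x * x powr (- b) \<le> (\<Sum>k. f k x)" for x
    proof (cases "x \<in> A")
      case True
      then have x: "1 \<le> x" using A by auto
      \<comment> \<open>The least power of two above \<open>x\<close> is \<open>2 ^ Suc k\<close>,
        because \<open>1 \<le> x\<close> excludes the exponent 0; its predecessor is the left end of
        the block that contains \<open>x\<close>.\<close>
      define n where "n = (LEAST n. x < 2 ^ n)"
      have n: "x < 2 ^ n"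
        unfolding n_def using real_arch_pow[of 2 x] by (auto intro: LeastI_ex)
      with x obtain k where "n = Suc k"
        by (cases n) auto
      then have k: "2 ^ k \<le> x" "x < 2 * 2 ^ k"
        using n not_less_Least[of k "\<lambda>n. x < 2 ^ n"] by (auto simp: n_def not_less)
      have "x powr (- b) \<le> (2 ^ k) powr (- b)"
        using k b by (intro powr_mono2') auto
      also have "\<dots> = f k x"
        using k True by (simp add: f_def)
      also have "\<dots> \<le> (\<Sum>k. f k x)"
        using sum_le_suminf[OF f_summable[of x], of "{k}"] f_nonneg by auto
      finally show ?thesis
        using True by simp
    qed (auto intro!: suminf_nonneg f_summable f_nonneg)
    then show "AE x in lborel. norm (indicator A x * x powr (- b)) \<le> norm (\<Sum>k. f k x)"
      by (auto simp: abs_mult intro: order_trans[OF _ abs_ge_self])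
  qed simp
qed

text \<open>The ray accumulates at its point \<open>c + 1\<close>, so the identity theorem applies.
  This reduces identities between transforms to real arguments.\<close>

lemma zero_on_real_ray_imp_zero:
  assumes f: "f holomorphic_on S" "open S" "connected S"
    and ray: "\<And>x. x > c \<Longrightarrow> complex_of_real x \<in> S" "\<And>x. x > c \<Longrightarrow> f (complex_of_real x) = 0"
    and "z \<in> S"
  shows "f z = 0"
proof (rule analytic_continuation[OF f])
  show "complex_of_real ` {c<..} \<subseteq> S" "complex_of_real (c + 1) \<in> S"
    using ray(1) ray(1)[of "c + 1"] by auto
  show "complex_of_real (c + 1) islimpt complex_of_real ` {c<..}"
    unfolding islimpt_approachable
  proof (intro allI impI)
    fix e :: real assume "e > 0"
    then show "\<exists>y\<in>complex_of_real ` {c<..}. y \<noteq> complex_of_real (c + 1) \<and> dist y (complex_of_real (c + 1)) < e"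
      by (intro bexI[of _ "complex_of_real (c + 1 + e / 2)"] imageI) (auto simp: dist_norm norm_divide)
  qed
qed (use assms in auto)

section \<open>Mellin transforms as Laplace transforms in the variable \<open>ln x\<close>\<close>

text \<open>The factor \<open>1 / x\<close> supplies the invariant measure \<open>dx / x\<close>,
  and the cutoff at 1 keeps \<open>ln\<close> nonnegative on the support, as
  \<open>nonneg_laplace\<close> demands.\<close>

definition mellin_weight :: "(real \<Rightarrow> real) \<Rightarrow> real \<Rightarrow> real" where
  "mellin_weight g x = indicator {1..} x * g x / x"

lemma mellin_weight_times_exp:
  "mellin_weight g x * exp (- (b * ln x)) = indicator {1..} x * g x * x powr (- b - 1)"
proof (cases "1 \<le> x")
  case True
  then have "x powr (- b - 1) = exp (- (b * ln x)) / x"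
    by (simp add: powr_diff powr_def[of _ "-b"])
  then show ?thesis
    by (simp add: mellin_weight_def)
qed (simp add: mellin_weight_def)

lemma nonneg_laplace_mellin:
  assumes "g \<in> borel_measurable borel" "\<And>x. 0 \<le> g x"
  shows "nonneg_laplace lborel ln (mellin_weight g)"
  using assms unfolding mellin_weight_def
  by unfold_locales (auto simp: indicator_def split: if_splits)

lemma mult_powr_minus:
  fixes x b :: real
  assumes "0 < x"
  shows "x * x powr (- b - 1) = x powr (- b)"
  using assms by (simp add: powr_mult_base)

lemma mellin_converges:
  fixes b B :: real
  assumes [measurable]: "g \<in> borel_measurable borel"
    and bound: "\<And>x. 1 \<le> x \<Longrightarrow> \<bar>g x\<bar> \<le> B * x" and b: "b > 1"
  shows "integrable lborel (\<lambda>x. indicator {1..} x * g x * x powr (- b - 1))"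
proof (rule Bochner_Integration.integrable_bound)
  show "integrable lborel (\<lambda>x. B * (indicator {1..} x * x powr (- (b - 1) - 1)))"
    using powr_tail_integral[of "b - 1" 1] b by (auto simp: has_bochner_integral_iff)
  have "\<bar>g x\<bar> * x powr (- b - 1) \<le> B * x powr (- (b - 1) - 1)" if "1 \<le> x" for x
  proof -
    have "\<bar>g x\<bar> * x powr (- b - 1) \<le> B * x * x powr (- b - 1)"
      using bound[OF that] by (intro mult_right_mono) auto
    also have "\<dots> = B * x powr (- (b - 1) - 1)"
      using that by (simp add: mult.assoc mult_powr_minus)
    finally show ?thesis .
  qed
  then show "AE x in lborel. norm (indicator {1..} x * g x * x powr (- b - 1))
      \<le> norm (B * (indicator {1..} x * x powr (- (b - 1) - 1)))"
    by (intro AE_I2) (auto simp: indicator_def abs_mult intro: order_trans[OF _ abs_ge_self] order_trans[OF _ mult_right_mono[OF abs_ge_self]])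
qed simp

text \<open>In the application \<open>D\<close> is \<open>\<plusminus>\<Delta>\<close> and \<open>Z\<close> is \<open>\<plusminus>\<zeta>\<close> with the same sign. The transform is only
  required to be known on the real axis; the identity theorem supplies the complex arguments.\<close>

theorem one_sided_oscillation:
  fixes D :: "real \<Rightarrow> real" and Z :: "complex \<Rightarrow> complex"
  assumes D_meas [measurable]: "D \<in> borel_measurable borel"
    and D_bound: "\<And>x. 1 \<le> x \<Longrightarrow> \<bar>D x\<bar> \<le> B * x"
    and \<epsilon>: "0 < \<epsilon>" "\<epsilon> < 1" and C: "C > 0"
    and small: "\<forall>\<^sub>F T in at_top. measure lborel ({x. 1 \<le> x \<and> D x > C * x powr (1 - \<epsilon>)} \<inter> {T..2 * T})
        \<le> T powr (1 - 2 * \<epsilon>)"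
    and Z: "Z holomorphic_on {s. Re s > 1 - \<epsilon>} - {1}" "is_pole Z 1"
    and nz: "\<And>s. s \<in> ball 1 (2 * \<epsilon>) - {1} \<Longrightarrow> Z s \<noteq> 0"
    and mellin: "\<And>b. b > 1 \<Longrightarrow>
        of_real (b * (\<integral>x. indicator {1..} x * D x * x powr (- b - 1) \<partial>lborel)) * Z (of_real b) = 1"
    and \<rho>: "Re \<rho> > 1 - \<epsilon>" "\<rho> \<noteq> 1"
  shows "Z \<rho> \<noteq> 0"
proof -
  define H where "H = {s. Re s > 1 - \<epsilon>}"
  define gp where "gp = (\<lambda>x. max 0 (C * x powr (1 - \<epsilon>) - D x))"
  define gm where "gm = (\<lambda>x. max 0 (D x - C * x powr (1 - \<epsilon>)))"
  define P where "P = laplace lborel ln (mellin_weight gp)"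
  define N where "N = laplace lborel ln (mellin_weight gm)"
  define A where "A = {x. 1 \<le> x \<and> D x > C * x powr (1 - \<epsilon>)}"
  have [measurable]: "gp \<in> borel_measurable borel" "gm \<in> borel_measurable borel"
    unfolding gp_def gm_def by measurable
  have [measurable]: "A \<in> sets borel"
    unfolding A_def by measurable
  interpret P: nonneg_laplace lborel ln "mellin_weight gp"
    by (rule nonneg_laplace_mellin) (auto simp: gp_def)
  interpret N: nonneg_laplace lborel ln "mellin_weight gm"
    by (rule nonneg_laplace_mellin) (auto simp: gm_def)
  have bound: "\<bar>gp x\<bar> \<le> (B + C) * x" "\<bar>gm x\<bar> \<le> (B + C) * x" if "1 \<le> x" for x
  proof -
    have "x powr (1 - \<epsilon>) \<le> x powr 1"
      using that \<epsilon> by (intro powr_mono) auto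
    then have "C * x powr (1 - \<epsilon>) \<le> C * x" "0 \<le> C * x powr (1 - \<epsilon>)"
      using that C by auto
    then show "\<bar>gp x\<bar> \<le> (B + C) * x" "\<bar>gm x\<bar> \<le> (B + C) * x"
      using D_bound[OF that] by (auto simp: gp_def gm_def ring_distribs)
  qed
  have int_gt1: "integrable lborel (\<lambda>x. indicator {1..} x * g x * x powr (- b - 1))"
    if "b > 1" "g = gp \<or> g = gm" for b g
    using that bound by (intro mellin_converges[where B = "B + C"]) auto
  have P_gt1: "laplace_converges lborel ln (mellin_weight gp) b" if "b > 1" for b
    using int_gt1[OF that] by (simp add: laplace_converges_def mellin_weight_times_exp)
  \<comment> \<open>On the range \<open>1 \<le> x\<close> the function \<open>gm\<close> vanishes
    outside \<open>A\<close>. On \<open>A\<close> the trivial bound \<open>gm x \<le> B * x\<close>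
    leaves \<open>B * x powr (- b)\<close>, to which the dyadic criterion with exponent
    \<open>1 - 2 * \<epsilon>\<close> applies.\<close>
  have N_conv: "laplace_converges lborel ln (mellin_weight gm) b" if "b > 1 - \<epsilon>" for b
    unfolding laplace_converges_def mellin_weight_times_exp
  proof (rule Bochner_Integration.integrable_bound)
    show "integrable lborel (\<lambda>x. B * (indicator A x * x powr (- b)))"
    proof (intro integrable_mult_right dyadic_integrable)
      show "\<forall>\<^sub>F T in at_top. measure lborel (A \<inter> {T..2 * T}) \<le> T powr (1 - 2 * \<epsilon>)"
        using small by (simp add: A_def)
    qed (use \<epsilon> that in \<open>auto simp: A_def\<close>)
    have "norm (indicator {1..} x * gm x * x powr (- b - 1)) \<le> B * (indicator A x * x powr (- b))" for x
    proof (cases "x \<in> A")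
      case True
      then have x: "1 \<le> x" by (simp add: A_def)
      have "0 \<le> C * x powr (1 - \<epsilon>)" using C by simp
      then have "\<bar>gm x\<bar> \<le> B * x"
        using True D_bound[OF x] by (simp add: A_def gm_def)
      then have "\<bar>gm x\<bar> * x powr (- b - 1) \<le> B * x * x powr (- b - 1)"
        by (intro mult_right_mono) auto
      also have "\<dots> = B * x powr (- b)"
        using x by (simp add: mult.assoc mult_powr_minus)
      finally show ?thesis
        using True x by (simp add: abs_mult)
    qed (auto simp: A_def gm_def indicator_def)
    then show "AE x in lborel. norm (indicator {1..} x * gm x * x powr (- b - 1))
        \<le> norm (B * (indicator A x * x powr (- b)))"
      by (intro AE_I2) (metis abs_ge_self order_trans real_norm_def)
  qed simp
  \<comment> \<open>Integrating \<open>gp x - gm x = C * x powr (1 - \<epsilon>) - D x\<close>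
    against \<open>x powr (- b - 1)\<close> expresses the transform of \<open>D\<close> by
    \<open>P\<close>, \<open>N\<close> and an explicit fraction; \<open>mellin\<close> then relates
    it to \<open>Z\<close>.\<close>
  have PN_real: "of_real b * (C / (of_real b - (1 - \<epsilon>)) - P (of_real b) + N (of_real b)) * Z (of_real b) = 1"
    if b: "b > 1" for b
  proof -
    have lap: "laplace lborel ln (mellin_weight g) (of_real b)
        = of_real (\<integral>x. indicator {1..} x * g x * x powr (- b - 1) \<partial>lborel)" for g
    proof -
      have "laplace lborel ln (mellin_weight g) (of_real b)
          = (\<integral>x. of_real (mellin_weight g x * exp (- (b * ln x))) \<partial>lborel)"
        unfolding laplace_def by (simp flip: exp_of_real)
      then show ?thesis
        by (simp only: mellin_weight_times_exp integral_complex_of_real)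
    qed
    have main: "has_bochner_integral lborel (\<lambda>x. indicator {1..} x * (C * x powr (1 - \<epsilon>)) * x powr (- b - 1))
        (C / (b - (1 - \<epsilon>)))"
    proof -
      have "has_bochner_integral lborel (\<lambda>x. C * (indicator {1..} x * x powr (- (b - (1 - \<epsilon>)) - 1)))
          (C * (1 powr (- (b - (1 - \<epsilon>))) / (b - (1 - \<epsilon>))))"
        using b \<epsilon> by (intro has_bochner_integral_mult_right powr_tail_integral) auto
      moreover have "C * (indicator {1..} x * x powr (- (b - (1 - \<epsilon>)) - 1))
          = indicator {1..} x * (C * x powr (1 - \<epsilon>)) * x powr (- b - 1)" for x
        by (simp add: algebra_simps flip: powr_add)
      ultimately show ?thesis
        by (simp only: powr_one_eq_one mult_1_right times_divide_eq_right)
    qed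
    have "(\<integral>x. indicator {1..} x * gp x * x powr (- b - 1) \<partial>lborel)
          - (\<integral>x. indicator {1..} x * gm x * x powr (- b - 1) \<partial>lborel)
        = (\<integral>x. indicator {1..} x * gp x * x powr (- b - 1) - indicator {1..} x * gm x * x powr (- b - 1) \<partial>lborel)"
      using int_gt1[OF b] by simp
    also have "\<dots> = (\<integral>x. indicator {1..} x * (C * x powr (1 - \<epsilon>)) * x powr (- b - 1)
        - indicator {1..} x * D x * x powr (- b - 1) \<partial>lborel)"
      by (intro Bochner_Integration.integral_cong) (auto simp: gp_def gm_def max_def algebra_simps)
    also have "\<dots> = C / (b - (1 - \<epsilon>)) - (\<integral>x. indicator {1..} x * D x * x powr (- b - 1) \<partial>lborel)"
      using main mellin_converges[OF D_meas D_bound b] by (simp add: has_bochner_integral_iff)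
    finally have "C / (b - (1 - \<epsilon>)) - (\<integral>x. indicator {1..} x * gp x * x powr (- b - 1) \<partial>lborel)
          + (\<integral>x. indicator {1..} x * gm x * x powr (- b - 1) \<partial>lborel)
        = (\<integral>x. indicator {1..} x * D x * x powr (- b - 1) \<partial>lborel)"
      by simp
    then have "of_real (C / (b - (1 - \<epsilon>))) - P (of_real b) + N (of_real b)
        = complex_of_real (\<integral>x. indicator {1..} x * D x * x powr (- b - 1) \<partial>lborel)"
      unfolding P_def N_def lap by (simp only: flip: of_real_diff of_real_add)
    then show ?thesis
      using mellin[OF b] by simp
  qed
  have N_holo: "N holomorphic_on H"
    unfolding N_def H_def by (rule N.laplace_holomorphic) (rule N_conv)
  \<comment> \<open>The relation is kept multiplied out, so \<open>G\<close> is holomorphic even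
    where \<open>Z\<close> might vanish; at a zero of \<open>Z\<close> its value is -1.\<close>
  define G where "G = (\<lambda>s::complex. s * (C / (s - (1 - \<epsilon>)) - P s + N s) * Z s - 1)"
  have G_zero: "G s = 0" if P: "P holomorphic_on S" and S: "open S" "connected S" "S \<subseteq> H - {1}"
    and "s \<in> S" and ray: "\<And>x. x > 1 \<Longrightarrow> complex_of_real x \<in> S" for S s
  proof (rule zero_on_real_ray_imp_zero[where f = G and S = S and c = 1])
    have "s - (1 - complex_of_real \<epsilon>) \<noteq> 0" if "s \<in> S" for s
    proof
      assume "s - (1 - complex_of_real \<epsilon>) = 0"
      then have "s = complex_of_real (1 - \<epsilon>)" by simp
      then show False using S that by (auto simp: H_def)
    qed
    then show "G holomorphic_on S"
      unfolding G_def using P N_holo Z S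
      by (intro holomorphic_intros) (auto simp: H_def elim!: holomorphic_on_subset)
  qed (use S that PN_real in \<open>auto simp: G_def\<close>)
  have P_eq: "P s = C / (s - (1 - \<epsilon>)) + N s - inverse (Z s) / s" and Z_nz: "Z s \<noteq> 0"
    if s: "Re s > 1" for s :: complex
  proof -
    have "P holomorphic_on {s. Re s > 1}"
      unfolding P_def by (rule P.laplace_holomorphic) (rule P_gt1)
    then have "G s = 0"
      by (rule G_zero) (use \<epsilon> s in \<open>auto simp: H_def open_halfspace_Re_gt convex_halfspace_Re_gt intro!: convex_connected\<close>)
    then have eq: "s * (C / (s - (1 - \<epsilon>)) - P s + N s) * Z s = 1"
      by (simp add: G_def)
    then show "Z s \<noteq> 0" by auto
    with eq s show "P s = C / (s - (1 - \<epsilon>)) + N s - inverse (Z s) / s"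
      by (cases "s = 0") (auto simp: field_simps)
  qed
  \<comment> \<open>A convex strip around the real ray. Its points with real part at most 1 lie in
    the ball of radius \<open>2 * \<epsilon>\<close> about 1, where \<open>nz\<close> excludes
    zeros; further right \<open>Z_nz\<close> does.\<close>
  define U where "U = {s. Re s > 1 - \<epsilon>} \<inter> ({s. Im s > - \<epsilon>} \<inter> {s. Im s < \<epsilon>})"
  have U: "open U" "convex U" "U \<subseteq> H"
    unfolding U_def H_def
    by (auto intro!: open_Int open_halfspace_Re_gt open_halfspace_Im_gt open_halfspace_Im_lt
        convex_Int convex_halfspace_Re_gt convex_halfspace_Im_gt convex_halfspace_Im_lt)
  have Z_nz_U: "Z s \<noteq> 0" if "s \<in> U - {1}" for s
  proof (cases "Re s > 1")
    case False
    then have "\<bar>Re (s - 1)\<bar> + \<bar>Im (s - 1)\<bar> < 2 * \<epsilon>"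
      using that by (auto simp: U_def)
    then have "norm (s - 1) < 2 * \<epsilon>"
      using cmod_le[of "s - 1"] by linarith
    then show ?thesis
      using that by (intro nz) (auto simp: dist_norm norm_minus_commute)
  qed (simp add: Z_nz)
  \<comment> \<open>The reciprocal of \<open>Z\<close> has a removable singularity at the pole,
    filled with the value 0; Landau's theorem needs a function holomorphic across 1.\<close>
  define Zi where "Zi = (\<lambda>s. if s = 1 then 0 else inverse (Z s))"
  have Zi_holo: "Zi holomorphic_on U"
    unfolding Zi_def
    using U Z Z_nz_U by (intro is_pole_inverse_holomorphic) (auto simp: H_def elim!: holomorphic_on_subset)
  define F where "F = (\<lambda>s::complex. C / (s - (1 - \<epsilon>)) + N s - Zi s / s)"
  have P_conv: "laplace_converges lborel ln (mellin_weight gp) b" if "b > 1 - \<epsilon>" for b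
  proof (rule P.landau[where F = F and U = U and \<beta> = 2 and \<alpha> = "1 - \<epsilon>"])
    show "laplace_converges lborel ln (mellin_weight gp) 2"
      by (rule P_gt1) simp
    have "s \<noteq> 0 \<and> s - (1 - complex_of_real \<epsilon>) \<noteq> 0" if "s \<in> U" for s
      using that \<epsilon> by (auto simp: U_def complex_eq_iff)
    then show "F holomorphic_on U"
      unfolding F_def using N_holo U by (intro holomorphic_intros Zi_holo) (auto elim!: holomorphic_on_subset)
    show "F s = laplace lborel ln (mellin_weight gp) s"
      if "s \<in> U" "2 < Re s" for s
      using P_eq[of s] that by (auto simp: F_def P_def Zi_def)
  qed (use U that \<epsilon> in \<open>auto simp: U_def\<close>)
  have "P holomorphic_on H"
    unfolding P_def H_def by (rule P.laplace_holomorphic) (rule P_conv)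
  \<comment> \<open>Puncturing the half-plane at 1 keeps it connected, so the vanishing of
    \<open>G\<close> on the real ray spreads to \<rho>, however large its imaginary part.\<close>
  then have "P holomorphic_on H - {1}"
    by (rule holomorphic_on_subset) auto
  moreover have "open (H - {1})"
    unfolding H_def by (intro open_delete open_halfspace_Re_gt)
  moreover have "connected (H - {1})"
    unfolding H_def by (intro connected_open_delete convex_connected convex_halfspace_Re_gt open_halfspace_Re_gt) auto
  ultimately have "G \<rho> = 0"
    by (rule G_zero) (use \<epsilon> \<rho> in \<open>auto simp: H_def open_halfspace_Re_gt intro!: open_delete\<close>)
  then show ?thesis
    by (auto simp: G_def)
qed

section \<open>The Moebius sum of a Beurling system\<close>

text \<open>Linear growth of the counting function governs the convergence questions below.
  Finiteness is a separate assumption because \<open>card\<close> is 0 on infinite sets, so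
  \<open>N_le\<close> alone would not give it.\<close>

locale beurling_system =
  fixes p :: "nat \<Rightarrow> real" and B :: real
  assumes primes: "beurling_primes p"
    and finite_upto: "finite (beurling_upto p x)"
    and N_le: "1 \<le> x \<Longrightarrow> real (beurling_N p x) \<le> B * x"
begin

lemma p_gt_1: "p j > 1"
  using primes by (simp add: beurling_primes_def)

lemma value_ge_1: "1 \<le> beurling_value p M"
proof (induction M)
  case (add j M)
  then show ?case
    using mult_mono[of 1 "p j" 1 "beurling_value p M"] p_gt_1[of j]
    by (simp add: beurling_value_def)
qed (simp add: beurling_value_def)

lemma value_single: "beurling_value p {#j#} = p j"
  by (simp add: beurling_value_def)

lemma value_mset_set: "beurling_value p (mset_set X) = prod p X"
  by (simp add: beurling_value_def prod_unfold_prod_mset)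

section \<open>The Dirichlet series of the Moebius function and the Euler product\<close>

text \<open>Partial summation in integral form: \<open>v powr (- b) / b\<close> is the integral of
  \<open>x powr (- b - 1)\<close> over \<open>x \<ge> v\<close>, so a finite sum becomes the
  integral of a counting function, which is at most \<open>B * x\<close>.\<close>

lemma summable_value_powr:
  assumes b: "b > 1"
  shows "(\<lambda>M. beurling_value p M powr (- b)) summable_on UNIV"
proof (rule nonneg_bdd_above_summable_on)
  let ?v = "beurling_value p"
  have "(\<Sum>M\<in>F. ?v M powr (- b)) \<le> b * (B / (b - 1))" if F: "finite F" for F
  proof -
    have *: "has_bochner_integral lborel (\<lambda>x. indicator {?v M..} x * x powr (- b - 1)) (?v M powr (- b) / b)" for M
      using b value_ge_1[of M] by (intro powr_tail_integral) auto
    have B: "has_bochner_integral lborel (\<lambda>x. B * (indicator {1..} x * x powr (- (b - 1) - 1))) (B * (1 powr (- (b - 1)) / (b - 1)))"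
      using b by (intro has_bochner_integral_mult_right powr_tail_integral) auto
    have "(\<Sum>M\<in>F. ?v M powr (- b) / b) = (\<integral>x. (\<Sum>M\<in>F. indicator {?v M..} x * x powr (- b - 1)) \<partial>lborel)"
      using has_bochner_integral_sum[of F lborel, OF *] by (simp add: has_bochner_integral_iff)
    also have "\<dots> \<le> (\<integral>x. B * (indicator {1..} x * x powr (- (b - 1) - 1)) \<partial>lborel)"
    proof (rule integral_mono)
      show "integrable lborel (\<lambda>x. \<Sum>M\<in>F. indicator {?v M..} x * x powr (- b - 1))"
        using * by (auto simp: has_bochner_integral_iff)
      show "integrable lborel (\<lambda>x. B * (indicator {1..} x * x powr (- (b - 1) - 1)))"
        using B by (simp only: has_bochner_integral_iff)
      fix x :: real
      show "(\<Sum>M\<in>F. indicator {?v M..} x * x powr (- b - 1)) \<le> B * (indicator {1..} x * x powr (- (b - 1) - 1))"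
      proof (cases "1 \<le> x")
        case True
        have "(\<Sum>M\<in>F. indicator {?v M..} x :: real) = card (F \<inter> beurling_upto p x)"
          using F by (simp add: indicator_def beurling_upto_def Int_def flip: sum.inter_filter)
        also have "\<dots> \<le> beurling_N p x"
          unfolding beurling_N_def using finite_upto by (intro of_nat_mono card_mono) auto
        also have "\<dots> \<le> B * x"
          using N_le True by simp
        finally have "(\<Sum>M\<in>F. indicator {?v M..} x) * x powr (- b - 1) \<le> B * x * x powr (- b - 1)"
          by (intro mult_right_mono) auto
        then show ?thesis
          using True by (simp add: sum_distrib_right mult.assoc mult_powr_minus)
      next
        case False
        then have "indicator {?v M..} x = (0::real)" for M
          using value_ge_1[of M] by auto
        then show ?thesis
          using False by simp
      qed
    qed
    also have "\<dots> = B / (b - 1)"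
      using B by (simp only: has_bochner_integral_iff powr_one_eq_one times_divide_eq_right mult_1_right)
    finally show ?thesis
      using b by (simp add: field_simps flip: sum_divide_distrib)
  qed
  then show "bdd_above (sum (\<lambda>M. ?v M powr (- b)) ` {F. F \<subseteq> UNIV \<and> finite F})"
    by (intro bdd_aboveI) auto
qed simp

lemma moebius_abs_le: "\<bar>beurling_moebius M\<bar> \<le> 1"
  by (simp add: beurling_moebius_def)

text \<open>The Dirichlet series of the reciprocal zeta function at a real point, as an unordered
  sum over all Beurling integers.\<close>

definition moebius_sum :: "real \<Rightarrow> real" where
  "moebius_sum b = infsum (\<lambda>M. beurling_moebius M * beurling_value p M powr (- b)) UNIV"

lemma has_sum_moebius:
  assumes "b > 1"
  shows "((\<lambda>M. beurling_moebius M * beurling_value p M powr (- b)) has_sum moebius_sum b) UNIV"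
proof -
  have "(\<lambda>M. norm (beurling_moebius M * beurling_value p M powr (- b))) summable_on UNIV"
  proof (rule summable_on_comparison_test[OF summable_value_powr[OF assms]])
    show "norm (beurling_moebius M * beurling_value p M powr (- b)) \<le> beurling_value p M powr (- b)" for M
      using mult_right_mono[OF moebius_abs_le[of M], of "beurling_value p M powr (- b)"]
      by (simp add: abs_mult)
  qed auto
  then have "(\<lambda>M. beurling_moebius M * beurling_value p M powr (- b)) summable_on UNIV"
    by (rule abs_summable_summable)
  then show ?thesis
    unfolding moebius_sum_def by (rule has_sum_infsum)
qed

lemma moebius_mset_set:
  assumes "finite X"
  shows "beurling_moebius (mset_set X) = (- 1) ^ card X"
  using assms by (auto simp: beurling_moebius_def count_mset_set')

text \<open>Multiplying out the first \<open>n\<close> factors gives the sum of the series over the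
  squarefree integers built from the first \<open>n\<close> primes. These finite index sets exhaust
  the squarefree integers, which carry all nonzero terms, so unordered summability yields the
  limit.\<close>

lemma euler_partial_product_tendsto:
  assumes b: "b > 1"
  shows "(\<lambda>n. \<Prod>j<n. 1 - p j powr (- b)) \<longlonglongrightarrow> moebius_sum b"
proof -
  define f where "f = (\<lambda>M. beurling_moebius M * beurling_value p M powr (- b))"
  define A where "A = mset_set ` {X :: nat set. finite X}"
  define F where "F = (\<lambda>n::nat. mset_set ` Pow {..<n})"
  have "f M = 0" if "M \<notin> A" for M
  proof (rule ccontr)
    assume "f M \<noteq> 0"
    then have "\<forall>j. count M j \<le> 1"
      by (auto simp: f_def beurling_moebius_def split: if_splits)
    have "M = mset_set (set_mset M)"
    proof (rule multiset_eqI)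
      fix j
      show "count M j = count (mset_set (set_mset M)) j"
        using \<open>\<forall>j. count M j \<le> 1\<close>[rule_format, of j]
        by (cases "j \<in># M") (auto simp: count_mset_set' not_in_iff simp flip: count_greater_zero_iff)
    qed
    then show False
      using that by (auto simp: A_def)
  qed
  then have "(f has_sum moebius_sum b) A"
    using has_sum_moebius[OF b] unfolding f_def
    by (subst has_sum_cong_neutral[where T = UNIV]) auto
  moreover have "filterlim F (finite_subsets_at_top A) sequentially"
    unfolding filterlim_finite_subsets_at_top
  proof (intro allI impI)
    fix Y assume Y: "finite Y \<and> Y \<subseteq> A"
    \<comment> \<open>One more than every index in use; inserting 0 keeps \<open>Max\<close>
      meaningful when no index occurs.\<close>
    define n where "n = Suc (Max (insert 0 (\<Union>M\<in>Y. set_mset M)))"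
    have "\<forall>m\<ge>n. Y \<subseteq> F m"
    proof (intro allI impI subsetI)
      fix m M assume m: "n \<le> m" and M: "M \<in> Y"
      then obtain X where X: "finite X" "M = mset_set X"
        using Y by (auto simp: A_def)
      have "j < m" if "j \<in> X" for j
      proof -
        have "finite (insert 0 (\<Union>M\<in>Y. set_mset M))"
          using Y by simp
        moreover have "j \<in> set_mset M"
          using X that by simp
        then have "j \<in> insert 0 (\<Union>M\<in>Y. set_mset M)"
          using M by blast
        ultimately have "j \<le> Max (insert 0 (\<Union>M\<in>Y. set_mset M))"
          by (rule Max_ge)
        then show ?thesis
          using m by (simp add: n_def)
      qed
      then show "M \<in> F m"
        using X by (auto simp: F_def)
    qed
    moreover have "F m \<subseteq> A" for m
      by (auto simp: F_def A_def dest: finite_subset[OF _ finite_lessThan])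
    ultimately show "\<forall>\<^sub>F m in sequentially. finite (F m) \<and> Y \<subseteq> F m \<and> F m \<subseteq> A"
      by (auto simp: eventually_at_top_linorder F_def)
  qed
  ultimately have "(\<lambda>n. sum f (F n)) \<longlonglongrightarrow> moebius_sum b"
    unfolding has_sum_def by (rule filterlim_compose)
  moreover have "sum f (F n) = (\<Prod>j<n. 1 - p j powr (- b))" for n
  proof -
    have fin: "finite X" if "X \<in> Pow {..<n}" for X
      using that by (auto dest: finite_subset[OF _ finite_lessThan])
    have "sum f (F n) = (\<Sum>X\<in>Pow {..<n}. f (mset_set X))"
      unfolding F_def using fin by (subst sum.reindex) (auto intro!: inj_onI simp: o_def)
    also have "\<dots> = (\<Sum>X\<in>Pow {..<n}. (- 1) ^ card X * (\<Prod>j\<in>X. p j powr (- b)))"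
      using fin by (intro sum.cong) (auto simp: f_def moebius_mset_set value_mset_set prod_powr_distrib)
    also have "\<dots> = (\<Prod>j<n. 1 - p j powr (- b))"
      using prod_diff_conv_sum[of "{..<n}" "\<lambda>_. 1" "\<lambda>j. p j powr (- b)"] by simp
    finally show ?thesis .
  qed
  ultimately show ?thesis by simp
qed

text \<open>Summability of \<open>q\<close> gives convergence of the product in the strict sense,
  which excludes a zero limit when no factor vanishes; the product can then be inverted factor by
  factor.\<close>

lemma moebius_sum_times_euler_product:
  assumes b: "b > 1"
  shows "of_real (moebius_sum b) * beurling_euler_product p (of_real b) = 1"
proof -
  define q where "q = (\<lambda>j. p j powr (- b))"
  have q: "0 < q j" "q j < 1" for j
    using p_gt_1[of j] b powr_less_mono[of "- b" 0 "p j"] by (auto simp: q_def)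
  have "(\<lambda>M. beurling_value p M powr (- b)) summable_on range (\<lambda>j. {#j#})"
    by (rule summable_on_subset_banach[OF summable_value_powr[OF b]]) auto
  then have "summable q"
    by (subst (asm) summable_on_reindex)
       (auto intro!: injI summable_on_imp_summable simp: o_def value_single q_def)
  then have conv: "convergent_prod (\<lambda>j. 1 - q j)"
    using q summable_imp_convergent_prod_real[of "\<lambda>j. - q j"] by (simp add: less_imp_le less_le)
  have "(\<lambda>n. \<Prod>j\<le>n. 1 - q j) \<longlonglongrightarrow> moebius_sum b"
    using euler_partial_product_tendsto[OF b] LIMSEQ_lessThan_iff_atMost[of "prod (\<lambda>j. 1 - q j)"]
    by (simp add: q_def)
  with convergent_prod_LIMSEQ[OF conv] have eq: "prodinf (\<lambda>j. 1 - q j) = moebius_sum b"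
    by (rule LIMSEQ_unique)
  then have "moebius_sum b \<noteq> 0"
    using prodinf_nonzero[OF conv] q by (metis less_irrefl right_minus_eq)
  have hp: "(\<lambda>j. 1 - complex_of_real (q j)) has_prod complex_of_real (moebius_sum b)"
    using has_prod_of_real_iff[of "\<lambda>j. 1 - q j" "moebius_sum b", where 'a = complex] conv eq
    by (simp add: has_prod_iff)
  have "complex_of_real (p j) powr (- complex_of_real b) = of_real (q j)" for j
    using p_gt_1[of j] powr_of_real[of "p j" "- b"] by (simp add: q_def)
  then have "beurling_euler_product p (of_real b) = inverse (of_real (moebius_sum b))"
    using hp by (simp add: beurling_euler_product_def prodinf_inverse has_prod_iff)
  then show ?thesis
    using \<open>moebius_sum b \<noteq> 0\<close> by simp
qed

section \<open>The Mellin transform of \<open>beurling_Delta\<close>\<close>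

text \<open>The cutoff sits in the term and not in the index set, so \<open>beurling_Delta\<close>
  becomes a series over a fixed index set that can be integrated term by term.\<close>

definition Delta_term :: "real \<Rightarrow> nat multiset \<Rightarrow> real" where
  "Delta_term x M = beurling_moebius M *
     ((if beurling_value p M < x then 1 else 0) + (if beurling_value p M = x then 1 / 2 else 0))"

abbreviation enum :: "nat \<Rightarrow> nat multiset" where
  "enum \<equiv> from_nat_into UNIV"

lemma bij_enum: "bij_betw enum UNIV UNIV"
proof (rule bij_betw_from_nat_into)
  have "inj (\<lambda>n. replicate_mset n (0::nat))"
    by (rule injI) (metis size_replicate_mset)
  then show "infinite (UNIV :: nat multiset set)"
    unfolding infinite_iff_countable_subset by blast
  have "countable (range (mset :: nat list \<Rightarrow> nat multiset))"
    by (rule countable_image) simp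
  then show "countable (UNIV :: nat multiset set)"
    by (simp add: surj_mset)
qed

lemma Delta_sums: "(\<lambda>n. Delta_term x (enum n)) sums beurling_Delta p x"
proof -
  define I where "I = enum -` beurling_upto p x"
  have bij: "bij_betw enum I (beurling_upto p x)"
    using bij_enum unfolding I_def by (auto simp: bij_betw_def inj_on_def surj_image_vimage_eq)
  then have "finite I"
    using finite_upto by (simp add: bij_betw_finite)
  have "(\<lambda>n. Delta_term x (enum n)) sums (\<Sum>n\<in>I. Delta_term x (enum n))"
    using \<open>finite I\<close> by (rule sums_finite) (auto simp: I_def Delta_term_def beurling_upto_def)
  also have "(\<Sum>n\<in>I. Delta_term x (enum n)) = (\<Sum>M\<in>beurling_upto p x. Delta_term x M)"
    using bij by (rule sum.reindex_bij_betw)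
  also have "\<dots> = beurling_Delta p x"
    unfolding beurling_Delta_def
    by (intro sum.cong) (auto simp: Delta_term_def beurling_upto_def)
  finally show ?thesis .
qed

lemma Delta_measurable [measurable]: "beurling_Delta p \<in> borel_measurable borel"
proof -
  have [measurable]: "(\<lambda>x. Delta_term x M) \<in> borel_measurable borel" for M
    unfolding Delta_term_def by measurable
  have "beurling_Delta p = (\<lambda>x. \<Sum>n. Delta_term x (enum n))"
    using Delta_sums by (auto simp: sums_iff)
  then show ?thesis by simp
qed

lemma Delta_abs_le:
  assumes "1 \<le> x"
  shows "\<bar>beurling_Delta p x\<bar> \<le> B * x"
proof -
  have "\<bar>beurling_Delta p x\<bar> \<le> (\<Sum>M\<in>beurling_upto p x. 1)"
    unfolding beurling_Delta_def
  proof (intro order_trans[OF sum_abs] sum_mono)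
    fix M
    have "\<bar>(if beurling_value p M = x then 1 / 2 else 1) * beurling_moebius M\<bar> \<le> 1 * 1"
      unfolding abs_mult by (intro mult_mono moebius_abs_le) auto
    then show "\<bar>(if beurling_value p M = x then 1 / 2 else 1) * beurling_moebius M\<bar> \<le> 1"
      by simp
  qed
  also have "\<dots> \<le> B * x"
    using N_le[OF assms] by (simp add: beurling_N_def)
  finally show ?thesis .
qed

text \<open>Each integer of value \<open>v\<close> contributes the tail integral
  \<open>v powr (- b) / b\<close> times its Moebius value; the L1 norms of the terms are summable
  for \<open>b > 1\<close>, which justifies integration term by term.\<close>

lemma mellin_Delta:
  assumes b: "b > 1"
  shows "b * (\<integral>x. indicator {1..} x * beurling_Delta p x * x powr (- b - 1) \<partial>lborel) = moebius_sum b"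
proof -
  let ?v = "beurling_value p"
  define h where "h = (\<lambda>n x. indicator {1..} x * Delta_term x (enum n) * x powr (- b - 1))"
  have [measurable]: "(\<lambda>x. Delta_term x M) \<in> borel_measurable borel" for M
    unfolding Delta_term_def by measurable
  have h_int: "has_bochner_integral lborel (h n) (beurling_moebius (enum n) * (?v (enum n) powr (- b) / b))" for n
  proof -
    have "has_bochner_integral lborel
        (\<lambda>x. beurling_moebius (enum n) * (indicator {?v (enum n)..} x * x powr (- b - 1)))
        (beurling_moebius (enum n) * (?v (enum n) powr (- b) / b))"
      using b value_ge_1[of "enum n"] by (intro has_bochner_integral_mult_right powr_tail_integral) auto
    \<comment> \<open>The weight 1/2 at equality affects the term at a single point only, a null
      set.\<close>
    moreover have "AE x in lborel. beurling_moebius (enum n) * (indicator {?v (enum n)..} x * x powr (- b - 1)) = h n x"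
      using AE_lborel_singleton[of "?v (enum n)"]
    proof eventually_elim
      case (elim x)
      then show ?case
        using value_ge_1[of "enum n"] by (auto simp: h_def Delta_term_def indicator_def)
    qed
    ultimately show ?thesis
      by (subst has_bochner_integral_cong_AE[symmetric]) (auto simp: h_def)
  qed
  have h_sums: "(\<lambda>n. h n x) sums (indicator {1..} x * beurling_Delta p x * x powr (- b - 1))" for x
    unfolding h_def by (intro sums_mult2 sums_mult Delta_sums)
  have "(\<lambda>n. integral\<^sup>L lborel (h n)) sums (\<integral>x. (\<Sum>n. h n x) \<partial>lborel)"
  proof (rule sums_integral)
    show "integrable lborel (h n)" for n
      using h_int by (simp add: has_bochner_integral_iff)
    have "summable (\<lambda>n. norm (h n x))" for x
    proof (rule summable_finite)
      have "bij_betw enum (enum -` beurling_upto p x) (beurling_upto p x)"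
        using bij_enum by (auto simp: bij_betw_def inj_on_def surj_image_vimage_eq)
      then show "finite (enum -` beurling_upto p x)"
        using finite_upto by (simp add: bij_betw_finite)
    qed (auto simp: h_def Delta_term_def beurling_upto_def)
    then show "AE x in lborel. summable (\<lambda>n. norm (h n x))" by simp
    show "summable (\<lambda>n. \<integral>x. norm (h n x) \<partial>lborel)"
    proof (rule summable_comparison_test)
      have "(\<lambda>n. ?v (enum n) powr (- b)) summable_on UNIV"
        using summable_value_powr[OF b]
        by (subst summable_on_reindex_bij_betw[OF bij_enum, where f = "\<lambda>M. ?v M powr (- b)"])
      then show "summable (\<lambda>n. ?v (enum n) powr (- b) / b)"
        by (intro summable_divide summable_on_imp_summable)
      have "(\<integral>x. norm (h n x) \<partial>lborel) \<le> ?v (enum n) powr (- b) / b" for n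
      proof -
        have "has_bochner_integral lborel (\<lambda>x. indicator {?v (enum n)..} x * x powr (- b - 1)) (?v (enum n) powr (- b) / b)"
          using b value_ge_1[of "enum n"] by (intro powr_tail_integral) auto
        moreover have "norm (h n x) \<le> indicator {?v (enum n)..} x * x powr (- b - 1)" for x
          using mult_right_mono[OF moebius_abs_le[of "enum n"], of "x powr (- b - 1)"]
          by (auto simp: h_def Delta_term_def indicator_def abs_mult)
        ultimately have "(\<integral>x. norm (h n x) \<partial>lborel)
            \<le> (\<integral>x. indicator {?v (enum n)..} x * x powr (- b - 1) \<partial>lborel)"
          using h_int[of n] by (intro integral_mono integrable_norm) (auto simp: has_bochner_integral_iff)
        also have "\<dots> = ?v (enum n) powr (- b) / b"
          using b value_ge_1[of "enum n"] powr_tail_integral[of b "?v (enum n)"]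
          by (simp add: has_bochner_integral_iff)
        finally show ?thesis .
      qed
      then show "\<exists>N. \<forall>n\<ge>N. norm (\<integral>x. norm (h n x) \<partial>lborel) \<le> ?v (enum n) powr (- b) / b"
        by simp
    qed
  qed
  then have "(\<lambda>n. beurling_moebius (enum n) * ?v (enum n) powr (- b) / b)
      sums (\<integral>x. indicator {1..} x * beurling_Delta p x * x powr (- b - 1) \<partial>lborel)"
    using h_int h_sums by (simp add: has_bochner_integral_iff sums_iff)
  moreover have "(\<lambda>n. beurling_moebius (enum n) * ?v (enum n) powr (- b) / b) sums (moebius_sum b / b)"
    using has_sum_moebius[OF b]
    by (intro sums_divide has_sum_imp_sums)
       (subst has_sum_reindex_bij_betw[OF bij_enum, where f = "\<lambda>M. beurling_moebius M * ?v M powr (- b)"])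
  ultimately have "(\<integral>x. indicator {1..} x * beurling_Delta p x * x powr (- b - 1) \<partial>lborel) = moebius_sum b / b"
    by (rule sums_unique2)
  then show ?thesis
    using b by simp
qed

end

section \<open>Zeros near the line of absolute convergence\<close>

text \<open>Since \<open>\<theta> < 1\<close>, the error is eventually below
  \<open>\<kappa> * x\<close>, which gives both a linear upper bound and positivity. As
  \<open>card\<close> of an infinite set is 0, positivity proves finiteness for large
  \<open>x\<close>, and monotonicity extends it to all \<open>x\<close>.\<close>

lemma beurling_system_if_N_asymp:
  assumes primes: "beurling_primes p" and \<kappa>: "\<kappa> > 0" and \<theta>: "\<theta> < 1"
    and N: "(\<lambda>x. real (beurling_N p x) - \<kappa> * x) \<in> O[at_top](\<lambda>x. x powr \<theta>)"
  shows "\<exists>B. beurling_system p B"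
proof -
  obtain c where c: "\<forall>\<^sub>F x in at_top. \<bar>real (beurling_N p x) - \<kappa> * x\<bar> \<le> c * x powr \<theta>"
    using N by (auto simp: bigo_def)
  have "((\<lambda>x::real. x powr (\<theta> - 1)) \<longlongrightarrow> 0) at_top"
    using \<theta> by (intro tendsto_neg_powr filterlim_ident) auto
  then have "((\<lambda>x. c * x powr (\<theta> - 1)) \<longlongrightarrow> c * 0) at_top"
    by (intro tendsto_intros)
  then have "\<forall>\<^sub>F x in at_top. c * x powr (\<theta> - 1) < \<kappa>"
    using \<kappa> by (intro order_tendstoD(2)) auto
  with c have "\<forall>\<^sub>F x in at_top. 0 < beurling_N p x \<and> real (beurling_N p x) \<le> 2 * \<kappa> * x"
    using eventually_gt_at_top[of 0]
  proof eventually_elim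
    case (elim x)
    have "c * x powr \<theta> = c * x powr (\<theta> - 1) * x"
      using elim powr_add[of x "\<theta> - 1" 1] by simp
    also have "\<dots> < \<kappa> * x"
      using elim by (intro mult_strict_right_mono) auto
    finally have "\<bar>real (beurling_N p x) - \<kappa> * x\<bar> < \<kappa> * x"
      using elim by linarith
    then have "0 < real (beurling_N p x)" "real (beurling_N p x) \<le> 2 * \<kappa> * x"
      by (auto simp: abs_less_iff)
    then show ?case by simp
  qed
  then obtain x0 where x0: "\<And>x. x \<ge> x0 \<Longrightarrow> 0 < beurling_N p x"
      "\<And>x. x \<ge> x0 \<Longrightarrow> real (beurling_N p x) \<le> 2 * \<kappa> * x"
    by (auto simp: eventually_at_top_linorder)
  have fin: "finite (beurling_upto p x)" for x
  proof (rule finite_subset)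
    show "beurling_upto p x \<subseteq> beurling_upto p (max x x0)"
      by (auto simp: beurling_upto_def)
    show "finite (beurling_upto p (max x x0))"
      using x0(1)[of "max x x0"] by (intro card_ge_0_finite) (auto simp: beurling_N_def)
  qed
  define B where "B = 2 * \<kappa> + real (beurling_N p x0)"
  have "real (beurling_N p x) \<le> B * x" if "1 \<le> x" for x
  proof (cases "x0 \<le> x")
    case True
    have "0 \<le> real (beurling_N p x0) * x"
      using that by simp
    then show ?thesis
      using x0(2)[OF True] by (simp add: B_def ring_distribs)
  next
    case False
    have "real (beurling_N p x) \<le> real (beurling_N p x0)"
      unfolding beurling_N_def using False
      by (intro of_nat_mono card_mono fin) (auto simp: beurling_upto_def)
    also have "\<dots> \<le> real (beurling_N p x0) * x"
      using that by (simp add: mult_le_cancel_left1)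
    also have "\<dots> \<le> B * x"
      using that \<kappa> by (intro mult_right_mono) (auto simp: B_def)
    finally show ?thesis .
  qed
  then have "beurling_system p B"
    using primes fin by unfold_locales
  then show ?thesis ..
qed

text \<open>Infinitely many zeros in a compact box accumulate at a point \<open>z\<close>, which
  differs from 1 because \<open>2 \<le> Im z\<close>. Then \<open>Z\<close> vanishes near
  \<open>z\<close> and, by the identity theorem on the connected set \<open>S\<close>, at
  \<open>s0\<close>.\<close>

lemma finite_zeros_in_box:
  fixes Z :: "complex \<Rightarrow> complex"
  assumes Z: "Z analytic_on ({s. \<theta> \<le> Re s} - {1})"
    and nz: "\<theta> < Re s0" "s0 \<noteq> 1" "Z s0 \<noteq> 0"
  shows "finite {s. \<theta> \<le> Re s \<and> Re s \<le> u \<and> 2 \<le> Im s \<and> Im s \<le> t \<and> Z s = 0}"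
proof (rule ccontr)
  define K where "K = cbox (Complex \<theta> 2) (Complex u t)"
  define S where "S = {s. \<theta> < Re s} - {1}"
  assume "\<not> finite {s. \<theta> \<le> Re s \<and> Re s \<le> u \<and> 2 \<le> Im s \<and> Im s \<le> t \<and> Z s = 0}"
  also have "{s. \<theta> \<le> Re s \<and> Re s \<le> u \<and> 2 \<le> Im s \<and> Im s \<le> t \<and> Z s = 0} = {s \<in> K. Z s = 0}"
    by (auto simp: K_def in_cbox_complex_iff)
  finally obtain z where z: "z \<in> K" "z islimpt {s \<in> K. Z s = 0}"
    using Heine_Borel_imp_Bolzano_Weierstrass[of K "{s \<in> K. Z s = 0}"] by (auto simp: K_def)
  have z': "\<theta> \<le> Re z" "2 \<le> Im z"
    using z by (auto simp: K_def in_cbox_complex_iff)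
  then have "z \<in> {s. \<theta> \<le> Re s} - {1}"
    by auto
  then obtain r where r: "r > 0" "Z holomorphic_on ball z r"
    using Z by (meson analytic_on_def)
  have lim: "z islimpt ({s \<in> K. Z s = 0} \<inter> ball z r)"
    using z(2) r(1) by (intro islimpt_Int_eventually eventually_at_in_open') auto
  have ball: "Z s = 0" if "s \<in> ball z r" for s
  proof (rule analytic_continuation[OF r(2)])
    show "{s \<in> K. Z s = 0} \<inter> ball z r \<subseteq> ball z r"
      by blast
    show "z islimpt ({s \<in> K. Z s = 0} \<inter> ball z r)"
      by (rule lim)
  qed (use that r(1) in auto)
  have "Z s0 = 0"
  proof (rule analytic_continuation_open[where f = Z and g = "\<lambda>_. 0" and s = "ball z r \<inter> S" and s' = S])
    \<comment> \<open>The accumulation point may lie on the boundary line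
      \<open>Re s = \<theta>\<close>; moving right by half the radius reaches the open set
      \<open>S\<close>.\<close>
    define w where "w = z + of_real (r / 2)"
    have "dist z w < r"
      using r(1) by (simp add: w_def dist_norm)
    moreover have "Re w > \<theta>" "Im w \<ge> 2"
      using r(1) z' by (auto simp: w_def)
    ultimately show "ball z r \<inter> S \<noteq> {}"
      by (auto simp: S_def intro!: exI[of _ w])
    show "open S"
      unfolding S_def by (intro open_delete open_halfspace_Re_gt)
    then show "open (ball z r \<inter> S)"
      by auto
    show "connected S"
      unfolding S_def
      by (intro connected_open_delete convex_connected convex_halfspace_Re_gt open_halfspace_Re_gt) auto
    show "Z holomorphic_on S"
      using analytic_imp_holomorphic[OF Z] by (rule holomorphic_on_subset) (auto simp: S_def)
  qed (use nz ball in \<open>auto simp: S_def\<close>)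
  with nz show False by simp
qed

text \<open>The upper limit is at most 0, so the quotient is eventually below any positive constant;
  1 is chosen.\<close>

lemma not_is_Omega_imp_eventually_less:
  assumes "\<not> is_Omega F f" "\<forall>\<^sub>F T in at_top. f T > 0"
  shows "\<forall>\<^sub>F T in at_top. F T < f T"
proof -
  have "Limsup at_top (\<lambda>T. ereal (F T / f T)) \<le> 0"
    using assms(1) by (simp add: is_Omega_def not_less)
  then have "Limsup at_top (\<lambda>T. ereal (F T / f T)) < 1"
    by (rule le_less_trans) simp
  then have "\<forall>\<^sub>F T in at_top. ereal (F T / f T) < 1"
    by (rule Limsup_lessD)
  then show ?thesis
    using assms(2) by eventually_elim (simp add: one_ereal_def field_simps)
qed

theorem mainTheorem7:
  fixes p :: "nat \<Rightarrow> real" and \<theta> a \<kappa> :: real and Z :: "complex \<Rightarrow> complex"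
  assumes theta: "1 / 2 < \<theta>" "\<theta> < 1"
    and a: "a > 4 / exp 1 * (1 - \<theta>)"
    and primes: "beurling_primes p"
    and kappa: "\<kappa> > 0"
    and N_asymp: "(\<lambda>x. real (beurling_N p x) - \<kappa> * x) \<in> O[at_top](\<lambda>x. x powr \<theta>)"
    and zeta: "beurling_zeta_continuation p \<theta> Z"
    and simple_pole: "is_pole Z 1" "zorder Z 1 = - 1"
    and residue: "residue Z 1 = of_real \<kappa>"
    and zeros_on_curve:
      "infinite {s. \<theta> \<le> Re s \<and> 2 \<le> Im s \<and> Re s = 1 - a / ln (Im s) \<and> Z s = 0}"
    and no_zeros_right:
      "\<And>s. \<theta> \<le> Re s \<Longrightarrow> 2 \<le> Im s \<Longrightarrow> Re s > 1 - a / ln (Im s) \<Longrightarrow> Z s \<noteq> 0"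
    and psi_asymp:
      "(\<lambda>x. beurling_psi p x - x) \<in> O[at_top](\<lambda>x. x * exp (- 2 * sqrt (a * ln x)))"
  shows "\<exists>\<epsilon>0>0. \<forall>\<epsilon>. 0 < \<epsilon> \<and> \<epsilon> < \<epsilon>0 \<longrightarrow> (\<forall>C>0.
           is_Omega (\<lambda>T. measure lebesgue (set_A1 p C \<epsilon> \<inter> {T..2 * T})) (\<lambda>T. T powr (1 - 2 * \<epsilon>)) \<and>
           is_Omega (\<lambda>T. measure lebesgue (set_A2 p C \<epsilon> \<inter> {T..2 * T})) (\<lambda>T. T powr (1 - 2 * \<epsilon>)))"
proof -
  obtain B where "beurling_system p B"
    using beurling_system_if_N_asymp[OF primes kappa theta(2) N_asymp] ..
  then interpret beurling_system p B .
  have Z_analytic: "Z analytic_on ({s. \<theta> \<le> Re s} - {1})"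
    and Z_euler: "\<And>s. 1 < Re s \<Longrightarrow> Z s = beurling_euler_product p s"
    using zeta by (auto simp: beurling_zeta_continuation_def)
  have moebius_Z: "of_real (moebius_sum b) * Z (of_real b) = 1" if "b > 1" for b
    using moebius_sum_times_euler_product[OF that] Z_euler[of "of_real b"] that by simp
  have "a > 0"
    using a theta by (smt (verit) divide_pos_pos exp_gt_zero mult_pos_pos)
  \<comment> \<open>A pole has a zero-free punctured neighbourhood, whose radius will limit
    \<epsilon>.\<close>
  have "\<forall>\<^sub>F s in at 1. Z s \<noteq> 0"
    using simple_pole(1) by (rule non_zero_neighbour_pole)
  then obtain \<eta> where \<eta>: "\<eta> > 0" "\<And>s. s \<noteq> 1 \<Longrightarrow> dist s 1 < \<eta> \<Longrightarrow> Z s \<noteq> 0"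
    by (auto simp: eventually_at)
  \<comment> \<open>A zero on the curve with real part at most \<open>1 - \<epsilon>\<close> has
    imaginary part at most \<open>exp (a / \<epsilon>)\<close>. If this held for all of them, they
    would lie in a compact box and be finite in number.\<close>
  have zero: "\<exists>\<rho>. Re \<rho> > 1 - \<epsilon> \<and> \<rho> \<noteq> 1 \<and> Z \<rho> = 0" if "\<epsilon> > 0" for \<epsilon>
  proof (rule ccontr)
    assume no_zero: "\<not> ?thesis"
    let ?S = "{s. \<theta> \<le> Re s \<and> 2 \<le> Im s \<and> Re s = 1 - a / ln (Im s) \<and> Z s = 0}"
    have "Re s \<le> 1 \<and> Im s \<le> exp (a / \<epsilon>)" if s: "s \<in> ?S" for s
    proof -
      have ln: "ln (Im s) > 0"
        using s by simp
      have "s \<noteq> 1"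
        using s by auto
      then have "\<not> Re s > 1 - \<epsilon>"
        using no_zero s by blast
      then have "\<epsilon> \<le> a / ln (Im s)"
        using s by simp
      then have "ln (Im s) \<le> a / \<epsilon>"
        using ln \<open>\<epsilon> > 0\<close> by (simp add: field_simps)
      then have "exp (ln (Im s)) \<le> exp (a / \<epsilon>)"
        by (rule iffD2[OF exp_le_cancel_iff])
      moreover have "exp (ln (Im s)) = Im s"
        using s by simp
      moreover have "0 < a / ln (Im s)"
        using ln \<open>a > 0\<close> by simp
      ultimately show ?thesis
        using s by simp
    qed
    then have "?S \<subseteq> {s. \<theta> \<le> Re s \<and> Re s \<le> 1 \<and> 2 \<le> Im s \<and> Im s \<le> exp (a / \<epsilon>) \<and> Z s = 0}"
      by blast
    moreover have "finite {s. \<theta> \<le> Re s \<and> Re s \<le> 1 \<and> 2 \<le> Im s \<and> Im s \<le> exp (a / \<epsilon>) \<and> Z s = 0}"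
      \<comment> \<open>The point 2 witnesses that \<open>Z\<close> is not identically zero: its
        value there times the Moebius sum is 1.\<close>
      using moebius_Z[of 2] theta by (intro finite_zeros_in_box[OF Z_analytic, of 2]) auto
    ultimately show False
      using zeros_on_curve finite_subset by blast
  qed
  \<comment> \<open>The sign \<sigma> treats both sets at once. The bound \<open>\<eta> / 2\<close>
    makes the ball of radius \<open>2 * \<epsilon>\<close> about 1 zero-free apart from its centre,
    and \<open>1 - \<theta>\<close> keeps the half-plane inside the domain of analyticity.\<close>
  have oscillation: "is_Omega (\<lambda>T. measure lebesgue ({x. 1 \<le> x \<and> \<sigma> * beurling_Delta p x > C * x powr (1 - \<epsilon>)} \<inter> {T..2 * T}))
      (\<lambda>T. T powr (1 - 2 * \<epsilon>))"
    if \<epsilon>: "0 < \<epsilon>" "\<epsilon> < min (\<eta> / 2) (1 - \<theta>)" and C: "C > 0" and \<sigma>: "\<sigma> = 1 \<or> \<sigma> = -1" for \<epsilon> C \<sigma> :: real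
  proof (rule ccontr)
    let ?A = "{x. 1 \<le> x \<and> \<sigma> * beurling_Delta p x > C * x powr (1 - \<epsilon>)}"
    assume "\<not> ?thesis"
    then have "\<forall>\<^sub>F T in at_top. measure lebesgue (?A \<inter> {T..2 * T}) < T powr (1 - 2 * \<epsilon>)"
      by (rule not_is_Omega_imp_eventually_less)
         (use eventually_gt_at_top[of 0] in eventually_elim, simp)
    moreover have "?A \<inter> {T..2 * T} \<in> sets lborel" for T
      by measurable
    ultimately have small: "\<forall>\<^sub>F T in at_top. measure lborel (?A \<inter> {T..2 * T}) \<le> T powr (1 - 2 * \<epsilon>)"
      by (simp add: less_imp_le eventually_mono)
    obtain \<rho> where \<rho>: "Re \<rho> > 1 - \<epsilon>" "\<rho> \<noteq> 1" "Z \<rho> = 0"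
      using zero \<epsilon> by blast
    have "of_real \<sigma> * Z \<rho> \<noteq> 0"
    proof (rule one_sided_oscillation[where D = "\<lambda>x. \<sigma> * beurling_Delta p x" and Z = "\<lambda>s. of_real \<sigma> * Z s"])
      show "(\<lambda>x. \<sigma> * beurling_Delta p x) \<in> borel_measurable borel"
        by measurable
      show "\<bar>\<sigma> * beurling_Delta p x\<bar> \<le> B * x" if "1 \<le> x" for x
        using Delta_abs_le[OF that] \<sigma> by auto
      show "(\<lambda>s. of_real \<sigma> * Z s) holomorphic_on {s. Re s > 1 - \<epsilon>} - {1}"
        using \<epsilon> by (intro holomorphic_intros holomorphic_on_subset[OF analytic_imp_holomorphic[OF Z_analytic]]) auto
      show "is_pole (\<lambda>s. of_real \<sigma> * Z s) 1"
        using simple_pole(1) \<sigma> by auto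
      show "of_real \<sigma> * Z s \<noteq> 0" if "s \<in> ball 1 (2 * \<epsilon>) - {1}" for s
        using \<eta>(2)[of s] that \<epsilon> \<sigma> by (auto simp: dist_commute)
      show "of_real (b * (\<integral>x. indicator {1..} x * (\<sigma> * beurling_Delta p x) * x powr (- b - 1) \<partial>lborel))
          * (of_real \<sigma> * Z (of_real b)) = 1" if "b > 1" for b
      proof -
        have "b * (\<integral>x. indicator {1..} x * (\<sigma> * beurling_Delta p x) * x powr (- b - 1) \<partial>lborel)
            = \<sigma> * moebius_sum b"
        proof -
          have "(\<lambda>x. indicator {1..} x * (\<sigma> * beurling_Delta p x) * x powr (- b - 1))
              = (\<lambda>x. \<sigma> * (indicator {1..} x * beurling_Delta p x * x powr (- b - 1)))"
            by (simp add: mult_ac)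
          then show ?thesis
            using mellin_Delta[OF that] by (simp only: integral_mult_right_zero mult.left_commute[of b])
        qed
        then show ?thesis
          using moebius_Z[OF that] \<sigma> by auto
      qed
    qed (use \<epsilon> C small \<rho> theta in auto)
    with \<rho> show False by simp
  qed
  show ?thesis
  proof (intro exI[of _ "min (\<eta> / 2) (1 - \<theta>)"] conjI allI impI)
    show "0 < min (\<eta> / 2) (1 - \<theta>)"
      using \<eta> theta by simp
  next
    fix \<epsilon> C :: real
    assume "0 < \<epsilon> \<and> \<epsilon> < min (\<eta> / 2) (1 - \<theta>)" "C > 0"
    then show "is_Omega (\<lambda>T. measure lebesgue (set_A1 p C \<epsilon> \<inter> {T..2 * T})) (\<lambda>T. T powr (1 - 2 * \<epsilon>))"
      using oscillation[of \<epsilon> C 1] by (simp add: set_A1_def)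
  next
    fix \<epsilon> C :: real
    assume "0 < \<epsilon> \<and> \<epsilon> < min (\<eta> / 2) (1 - \<theta>)" "C > 0"
    moreover have "set_A2 p C \<epsilon> = {x. 1 \<le> x \<and> (-1) * beurling_Delta p x > C * x powr (1 - \<epsilon>)}"
      by (auto simp: set_A2_def)
    ultimately show "is_Omega (\<lambda>T. measure lebesgue (set_A2 p C \<epsilon> \<inter> {T..2 * T})) (\<lambda>T. T powr (1 - 2 * \<epsilon>))"
      using oscillation[of \<epsilon> C "-1"] by simp
  qed
qed

end
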